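(* Let $A\in\mathbb{R}$, $k>0$, $L=2\pi/k$, $V_c>0$, let $N_x\ge 1$ be an integer and $N_v\ge 2$ an even integer, and put $\Delta x=L/N_x$, $\Delta v=2V_c/N_v$, $x_i=(i-\tfrac12)\Delta x$, $v_j=\left(j-\tfrac{N_v+1}{2}\right)\Delta v$. Let $f_{eq}$ be either $f_{eq}(v)=\frac{1}{\sqrt{2\pi}}e^{-v^2/2}$ or $f_{eq}(v)=\frac1\pi\frac{1}{v^2+1}$. Consider the piecewise constant ($l=0$) semi-discrete upwind discontinuous Galerkin scheme for $f_t+vf_x=0$ on $[0,L]\times[-V_c,V_c]$, periodic in $x$: $$\frac{d f_{ij}}{dt}+v_j\frac{f_{ij}-f_{i-1,j}}{\Delta x}=0\ \text{ if } v_j\ge 0,\qquad \frac{d f_{ij}}{dt}+v_j\frac{f_{i+1,j}-f_{ij}}{\Delta x}=0\ \text{ if } v_j<0,$$ for $1\le i\le N_x$, $1\le j\le N_v$ (index $i$ modulo $N_x$), with initial condition $f_{ij}(0)=\mathrm{Re}\left(A e^{\mathrm{i}kx_i}f_{eq}(v_j)\right)$. Then its solution is $$f_{ij}(t)=\mathrm{Re}\left(A e^{\mathrm{i}kx_i+s_jt}f_{eq}(v_j)\right),\qquad s_j=|v_j|\,\frac{\cos(k\Delta x)-1}{\Delta x}-v_j\,\frac{\sin(k\Delta x)}{\Delta x}\,\mathrm{i}.$$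
   Context: $\mathrm{i}$ denotes the imaginary unit (the subscript $i$ is the cell index in $x$). $f_{ij}(t)$ is the constant value of the numerical solution on the cell of the uniform mesh of $[0,L]\times[-V_c,V_c]$ centered at $(x_i,v_j)$. Time is continuous. *)

theory Defs
  imports Complex_Main
begin

definition maxwellian :: "real \<Rightarrow> real" where
  "maxwellian v = 1 / sqrt (2 * pi) * exp (- v\<^sup>2 / 2)"

definition lorentzian :: "real \<Rightarrow> real" where
  "lorentzian v = 1 / pi * (1 / (v\<^sup>2 + 1))"

text \<open>The neighbours of cell \<open>i\<close> in the cyclic index set \<open>{1..N}\<close>.\<close>

definition left_cell :: "nat \<Rightarrow> nat \<Rightarrow> nat" where
  "left_cell N i = (if i = 1 then N else i - 1)"

definition right_cell :: "nat \<Rightarrow> nat \<Rightarrow> nat" where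
  "right_cell N i = (if i = N then 1 else i + 1)"

text \<open>
  The cell values \<open>f i j t\<close> are constrained only for \<open>1 \<le> i \<le> Nx\<close>, \<open>1 \<le> j \<le> Nv\<close> and
  \<open>t \<ge> 0\<close>; at \<open>t = 0\<close> the derivative is one-sided.
\<close>

definition upwind_dg0 ::
  "nat \<Rightarrow> nat \<Rightarrow> real \<Rightarrow> (nat \<Rightarrow> real) \<Rightarrow> (nat \<Rightarrow> nat \<Rightarrow> real \<Rightarrow> real) \<Rightarrow> bool" where
  "upwind_dg0 Nx Nv dx v f \<longleftrightarrow>
    (\<forall>i\<in>{1..Nx}. \<forall>j\<in>{1..Nv}. \<forall>t\<ge>0. \<exists>D.
      (f i j has_real_derivative D) (at t within {0..}) \<and>
      (v j \<ge> 0 \<longrightarrow> D + v j * ((f i j t - f (left_cell Nx i) j t) / dx) = 0) \<and>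
      (v j < 0 \<longrightarrow> D + v j * ((f (right_cell Nx i) j t - f i j t) / dx) = 0))"

end

theory Submission
  imports Defs
begin

text \<open>
  For a fixed velocity index the scheme is a linear system on the cyclic set of cells:
  each cell relaxes, at rate \<open>c = \<bar>v\<bar> / \<Delta>x \<ge> 0\<close>, towards the cell upwind of it. In this form
  (\<open>upwind_dg0_iff\<close>) both signs of \<open>v\<close> can be treated together.

  The claimed function solves the system because \<open>k L = 2 \<pi>\<close>: the mode \<open>exp (\<i> k x\<^sub>i)\<close> is then
  well defined on the cyclic set, so passing to the upwind cell multiplies it by the fixed phase
  \<open>exp (\<mp> \<i> k \<Delta>x)\<close>, also across the periodic boundary (\<open>fourier_mode_upwind\<close>). It is therefore an
  eigenvector of the upwind difference operator, and \<open>s\<^sub>j\<close> is the eigenvalue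
  \<open>c (exp (\<mp> \<i> k \<Delta>x) - 1)\<close> (\<open>upwind_symbol\<close>). Taking real parts is harmless since the system has
  real coefficients.

  It is the only solution because the energy \<open>\<Sum>\<^sub>i (g i)\<^sup>2\<close> of the difference \<open>g\<close> of two solutions does
  not increase and vanishes initially: the upwind shift \<open>p\<close> permutes the cells, so by
  Cauchy-Schwarz \<open>\<Sum>\<^sub>i g i * g (p i) \<le> \<Sum>\<^sub>i (g i)\<^sup>2\<close> (\<open>relaxation_zero\<close>).
\<close>

definition upwind_cell :: "nat \<Rightarrow> real \<Rightarrow> nat \<Rightarrow> nat" where
  "upwind_cell N a i = (if a \<ge> 0 then left_cell N i else right_cell N i)"

lemma upwind_cell_bij:
  "bij_betw (upwind_cell N a) {1..N} {1..N}"
proof (cases "a \<ge> 0")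
  case True
  show ?thesis
    by (rule bij_betw_byWitness[where f' = "right_cell N"])
      (use True in \<open>auto simp: upwind_cell_def left_cell_def right_cell_def\<close>)
next
  case False
  show ?thesis
    by (rule bij_betw_byWitness[where f' = "left_cell N"])
      (use False in \<open>auto simp: upwind_cell_def left_cell_def right_cell_def\<close>)
qed

lemma upwind_cell_in:
  "i \<in> {1..N} \<Longrightarrow> upwind_cell N a i \<in> {1..N}"
  using upwind_cell_bij[of N a] by (auto simp: bij_betw_def)

lemma upwind_dg0_iff:
  assumes "dx > 0"
  shows "upwind_dg0 Nx Nv dx v f \<longleftrightarrow>
    (\<forall>i\<in>{1..Nx}. \<forall>j\<in>{1..Nv}. \<forall>t\<ge>0.
      (f i j has_real_derivative
        \<bar>v j\<bar> / dx * (f (upwind_cell Nx (v j) i) j t - f i j t)) (at t within {0..}))"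
proof -
  have "(\<exists>D. (f i j has_real_derivative D) (at t within {0..}) \<and>
      (v j \<ge> 0 \<longrightarrow> D + v j * ((f i j t - f (left_cell Nx i) j t) / dx) = 0) \<and>
      (v j < 0 \<longrightarrow> D + v j * ((f (right_cell Nx i) j t - f i j t) / dx) = 0))
    \<longleftrightarrow> (f i j has_real_derivative
        \<bar>v j\<bar> / dx * (f (upwind_cell Nx (v j) i) j t - f i j t)) (at t within {0..})"
    (is "(\<exists>D. ?der D \<and> ?P D \<and> ?Q D) \<longleftrightarrow> ?der ?E") for i j t
  proof -
    have "?P D \<and> ?Q D \<longleftrightarrow> D = ?E" for D
      using assms by (cases "v j \<ge> 0") (auto simp: upwind_cell_def field_simps)
    then show ?thesis by auto
  qed
  then show ?thesis
    unfolding upwind_dg0_def by simp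
qed

text \<open>
  Since \<open>2 a (b - a) \<le> b\<^sup>2 - a\<^sup>2\<close>, the squares on \<open>I\<close> grow in total at most at the rate
  \<open>c \<Sum>\<^sub>i ((g (p i))\<^sup>2 - (g i)\<^sup>2)\<close>, which is zero because \<open>p\<close> permutes \<open>I\<close>.
\<close>

lemma relaxation_zero:
  fixes g :: "'a \<Rightarrow> real \<Rightarrow> real"
  assumes "finite I" and p: "bij_betw p I I" and "c \<ge> 0"
    and der: "\<And>i t. i \<in> I \<Longrightarrow> t \<ge> 0 \<Longrightarrow>
      (g i has_real_derivative c * (g (p i) t - g i t)) (at t within {0..})"
    and init: "\<And>i. i \<in> I \<Longrightarrow> g i 0 = 0"
    and "i \<in> I" and "t \<ge> 0"
  shows "g i t = 0"
proof -
  define E where "E = (\<lambda>t. \<Sum>i\<in>I. (g i t)\<^sup>2)"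
  define E' where "E' = (\<lambda>t. \<Sum>i\<in>I. 2 * g i t * (c * (g (p i) t - g i t)))"
  have E_der: "(E has_real_derivative E' r) (at r within {0..})" if "r \<ge> 0" for r
    unfolding E_def E'_def
    by (intro derivative_eq_intros DERIV_sum) (auto intro!: derivative_eq_intros der that)
  have E'_nonpos: "E' r \<le> 0" for r
  proof -
    have "E' r \<le> (\<Sum>i\<in>I. c * ((g (p i) r)\<^sup>2 - (g i r)\<^sup>2))"
      unfolding E'_def
    proof (rule sum_mono)
      fix i
      have "2 * g i r * (g (p i) r - g i r) \<le> (g (p i) r)\<^sup>2 - (g i r)\<^sup>2"
        using zero_le_power2[of "g (p i) r - g i r"]
        by (simp add: power2_eq_square algebra_simps)
      from mult_left_mono[OF this \<open>c \<ge> 0\<close>]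
      show "2 * g i r * (c * (g (p i) r - g i r)) \<le> c * ((g (p i) r)\<^sup>2 - (g i r)\<^sup>2)"
        by (simp add: algebra_simps)
    qed
    also have "\<dots> = c * ((\<Sum>i\<in>I. (g (p i) r)\<^sup>2) - (\<Sum>i\<in>I. (g i r)\<^sup>2))"
      by (simp only: sum_distrib_left[symmetric] sum_subtractf)
    also have "(\<Sum>i\<in>I. (g (p i) r)\<^sup>2) = (\<Sum>i\<in>I. (g i r)\<^sup>2)"
      by (rule sum.reindex_bij_betw[OF p])
    finally show ?thesis by simp
  qed
  have "E t \<le> E 0"
  proof (rule DERIV_nonpos_imp_decreasing_open[OF \<open>t \<ge> 0\<close>])
    have "continuous_on {0..} E"
      by (rule DERIV_continuous_on[where D = E']) (simp add: E_der)
    then show "continuous_on {0..t} E"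
      by (rule continuous_on_subset) auto
  next
    fix r :: real assume "0 < r"
    then have "at r within {0..} = at r"
      by (intro at_within_nhd[of r "{0<..}"]) auto
    then show "\<exists>y. DERIV E r :> y \<and> y \<le> 0"
      using E_der[of r] E'_nonpos[of r] \<open>0 < r\<close> by auto
  qed
  also have "E 0 = 0"
    by (simp add: E_def init)
  finally have "E t = 0"
    using sum_nonneg[of I "\<lambda>i. (g i t)\<^sup>2"] by (simp add: E_def)
  then have "(g i t)\<^sup>2 = 0"
    using \<open>finite I\<close> \<open>i \<in> I\<close> by (simp add: E_def sum_nonneg_eq_0_iff)
  then show ?thesis by simp
qed

definition upwind_phase :: "real \<Rightarrow> real \<Rightarrow> complex" where
  "upwind_phase a \<theta> = (if a \<ge> 0 then cis (- \<theta>) else cis \<theta>)"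

lemma upwind_symbol:
  "complex_of_real (\<bar>a\<bar> * ((cos \<theta> - 1) / h)) - complex_of_real (a * (sin \<theta> / h)) * \<i>
    = complex_of_real (\<bar>a\<bar> / h) * (upwind_phase a \<theta> - 1)"
  by (auto simp: complex_eq_iff upwind_phase_def algebra_simps diff_divide_distrib)

text \<open>
  At the two boundary cells the position jumps by \<open>(N - 1) h\<close> in the wrong direction instead of
  moving by \<open>h\<close>; the discrepancy \<open>N h\<close> is one period, on which the mode is constant.
\<close>

lemma fourier_mode_upwind:
  assumes "i \<in> {1..N}" and period: "k * (real N * h) = 2 * pi"
  shows "cis (k * ((real (upwind_cell N a i) - 1 / 2) * h))
    = cis (k * ((real i - 1 / 2) * h)) * upwind_phase a (k * h)"
proof -
  have wrap: "cis (b + 2 * pi) = cis b" "cis (b - 2 * pi) = cis b" for b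
    by (simp_all add: complex_eq_iff cos_diff sin_diff)
  consider (left) "a \<ge> 0" "i \<noteq> 1" | (left_wrap) "a \<ge> 0" "i = 1"
    | (right) "a < 0" "i \<noteq> N" | (right_wrap) "a < 0" "i = N"
    by linarith
  then show ?thesis
  proof cases
    case left
    then have "real (i - 1) = real i - 1"
      using assms(1) by (simp add: of_nat_diff)
    with left show ?thesis
      by (simp add: upwind_cell_def left_cell_def upwind_phase_def cis_mult algebra_simps)
  next
    case left_wrap
    have "k * ((real N - 1 / 2) * h) = k * ((1 - 1 / 2) * h) + - (k * h) + 2 * pi"
      unfolding period[symmetric] by (simp add: algebra_simps)
    then have "cis (k * ((real N - 1 / 2) * h)) = cis (k * ((1 - 1 / 2) * h)) * cis (- (k * h))"
      by (simp only: wrap cis_mult)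
    with left_wrap show ?thesis
      by (simp add: upwind_cell_def left_cell_def upwind_phase_def)
  next
    case right
    then show ?thesis
      by (simp add: upwind_cell_def right_cell_def upwind_phase_def cis_mult algebra_simps)
  next
    case right_wrap
    have "k * ((1 - 1 / 2) * h) = k * ((real N - 1 / 2) * h) + k * h - 2 * pi"
      unfolding period[symmetric] by (simp add: algebra_simps)
    then have "cis (k * ((1 - 1 / 2) * h)) = cis (k * ((real N - 1 / 2) * h)) * cis (k * h)"
      by (simp only: wrap cis_mult)
    with right_wrap show ?thesis
      by (simp add: upwind_cell_def right_cell_def upwind_phase_def)
  qed
qed

lemma Re_exp_derivative:
  "((\<lambda>t. Re (a * exp (b + s * complex_of_real t) * c)) has_real_derivative
    Re (s * (a * exp (b + s * complex_of_real t) * c))) (at t within S)"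
proof -
  have "((\<lambda>t. a * exp (b + s * complex_of_real t) * c) has_vector_derivative
      s * (a * exp (b + s * complex_of_real t) * c)) (at t within S)"
    by (auto intro!: derivative_eq_intros has_vector_derivative_real_field simp: algebra_simps)
  from bounded_linear.has_vector_derivative[OF bounded_linear_Re this] show ?thesis
    by (simp add: has_real_derivative_iff_has_vector_derivative)
qed

theorem mainTheorem1:
  fixes A k L Vc dx dv :: real
    and Nx Nv :: nat
    and x v :: "nat \<Rightarrow> real"
    and feq :: "real \<Rightarrow> real"
    and s :: "nat \<Rightarrow> complex"
    and f :: "nat \<Rightarrow> nat \<Rightarrow> real \<Rightarrow> real"
  assumes "k > 0" and "L = 2 * pi / k" and "Vc > 0"
    and "Nx \<ge> 1" and "Nv \<ge> 2" and "even Nv"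
    and "dx = L / real Nx" and "dv = 2 * Vc / real Nv"
    and "\<And>i. x i = (real i - 1 / 2) * dx"
    and "\<And>j. v j = (real j - (real Nv + 1) / 2) * dv"
    and "feq = maxwellian \<or> feq = lorentzian"
    and "\<And>j. s j = complex_of_real (\<bar>v j\<bar> * ((cos (k * dx) - 1) / dx))
                   - complex_of_real (v j * (sin (k * dx) / dx)) * \<i>"
  shows "(upwind_dg0 Nx Nv dx v f \<and>
          (\<forall>i\<in>{1..Nx}. \<forall>j\<in>{1..Nv}.
            f i j 0 = Re (complex_of_real A * exp (\<i> * complex_of_real (k * x i))
                          * complex_of_real (feq (v j)))))
     \<longleftrightarrow> (\<forall>i\<in>{1..Nx}. \<forall>j\<in>{1..Nv}. \<forall>t\<ge>0.
            f i j t = Re (complex_of_real A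
                          * exp (\<i> * complex_of_real (k * x i) + s j * complex_of_real t)
                          * complex_of_real (feq (v j))))"
proof -
  define w where "w = (\<lambda>i j t. Re (complex_of_real A
      * exp (\<i> * complex_of_real (k * x i) + s j * complex_of_real t)
      * complex_of_real (feq (v j))))"
  define c where "c = (\<lambda>j. \<bar>v j\<bar> / dx)"
  let ?up = "\<lambda>j. upwind_cell Nx (v j)"
  have "dx > 0"
    using assms by simp
  then have c_nonneg: "c j \<ge> 0" for j
    by (simp add: c_def)
  have period: "k * (real Nx * dx) = 2 * pi"
    using assms by simp
  have w_der: "(w i j has_real_derivative c j * (w (?up j i) j t - w i j t)) (at t within {0..})"
    if "i \<in> {1..Nx}" for i j t
  proof -
    define W where "W = (\<lambda>i. complex_of_real A
        * exp (\<i> * complex_of_real (k * x i) + s j * complex_of_real t)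
        * complex_of_real (feq (v j)))"
    have w_W: "w i j t = Re (W i)" for i
      by (simp add: w_def W_def)
    have shift: "W (?up j i) = W i * upwind_phase (v j) (k * dx)"
      using fourier_mode_upwind[OF that period, of "v j"]
      unfolding W_def exp_add cis_conv_exp[symmetric] assms(9) by simp
    have "s j * W i = complex_of_real (c j) * (W (?up j i) - W i)"
      unfolding shift assms(12) upwind_symbol c_def by (simp add: algebra_simps)
    then have "Re (s j * W i) = c j * (w (?up j i) j t - w i j t)"
      by (simp add: w_W)
    then show ?thesis
      using Re_exp_derivative[of "complex_of_real A" "\<i> * complex_of_real (k * x i)" "s j"
          "complex_of_real (feq (v j))" t "{0..}"]
      by (simp add: w_def W_def)
  qed
  have "(upwind_dg0 Nx Nv dx v f \<and> (\<forall>i\<in>{1..Nx}. \<forall>j\<in>{1..Nv}. f i j 0 = w i j 0))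
    \<longleftrightarrow> (\<forall>i\<in>{1..Nx}. \<forall>j\<in>{1..Nv}. \<forall>t\<ge>0. f i j t = w i j t)" (is "?scheme \<longleftrightarrow> ?formula")
  proof
    assume ?scheme
    then have f_der: "(f i j has_real_derivative c j * (f (?up j i) j t - f i j t))
          (at t within {0..})" if "i \<in> {1..Nx}" "j \<in> {1..Nv}" "t \<ge> 0" for i j t
      using that \<open>dx > 0\<close> by (simp add: upwind_dg0_iff c_def)
    show ?formula
    proof (intro ballI allI impI)
      fix i j and t :: real
      assume i: "i \<in> {1..Nx}" and j: "j \<in> {1..Nv}" and t: "t \<ge> 0"
      have "f i j t - w i j t = 0"
      proof (rule relaxation_zero[where g = "\<lambda>i t. f i j t - w i j t",
            OF _ upwind_cell_bij c_nonneg _ _ i t])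
        fix i and r :: real
        assume i: "i \<in> {1..Nx}" and r: "r \<ge> 0"
        show "((\<lambda>t. f i j t - w i j t) has_real_derivative
            c j * (f (?up j i) j r - w (?up j i) j r - (f i j r - w i j r))) (at r within {0..})"
          using DERIV_diff[OF f_der[OF i j r] w_der[OF i, of j r]]
          by (simp add: algebra_simps)
      qed (use \<open>?scheme\<close> j in simp_all)
      then show "f i j t = w i j t" by simp
    qed
  next
    assume f: ?formula
    have "(f i j has_real_derivative c j * (f (?up j i) j t - f i j t)) (at t within {0..})"
      if "i \<in> {1..Nx}" "j \<in> {1..Nv}" "t \<ge> 0" for i j t
    proof -
      have "f i j t = w i j t" "f (?up j i) j t = w (?up j i) j t"
        using f that upwind_cell_in[OF that(1), of "v j"] by blast+
      then have "(w i j has_real_derivative c j * (f (?up j i) j t - f i j t)) (at t within {0..})"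
        using w_der[OF that(1), of j t] by simp
      then show ?thesis
        by (rule has_field_derivative_transform_within[OF _ zero_less_one])
          (use f that in auto)
    qed
    then have "upwind_dg0 Nx Nv dx v f"
      using \<open>dx > 0\<close> by (simp add: upwind_dg0_iff c_def)
    then show ?scheme
      using f by simp
  qed
  then show ?thesis
    by (simp add: w_def)
qed

end
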